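(* Let $h$ be a positive integer. For every multiplicative basis $A$ of order $h$ for $\mathbb{Z}^+$, we have $$\limsup_{x\to\infty}A(x)\frac{(\log x)^{1-\frac1h}}{x}\ \ge\ \frac{\sqrt[h]{h!}}{\Gamma\left(\frac1h\right)}.$$
   Context: $\mathbb{Z}^+$ denotes the set of positive integers and $\log$ the natural logarithm. A set $A\subseteq\mathbb{Z}^+$ is a multiplicative basis of order $h$ for $\mathbb{Z}^+$ if every positive integer can be written in the form $a_1\cdots a_h$ with $a_i\in A$ for all $1\le i\le h$ (repetitions allowed). The counting function of $A$ is $A(x)=|\{a\in A: a\le x\}|$. $\Gamma$ is the Euler gamma function. A limsup may equal $+\infty$. *)

theory Defs
  imports "HOL-Analysis.Analysis"
begin

definition multiplicative_basis :: "nat \<Rightarrow> nat set \<Rightarrow> bool" where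
  "multiplicative_basis h A \<longleftrightarrow>
     A \<subseteq> {0<..} \<and>
     (\<forall>n>0. \<exists>a :: nat \<Rightarrow> nat. (\<forall>i\<in>{1..h}. a i \<in> A) \<and> n = (\<Prod>i=1..h. a i))"

definition counting_function :: "nat set \<Rightarrow> real \<Rightarrow> nat" where
  "counting_function A x = card {a \<in> A. real a \<le> x}"

end

theory Submission
  imports Defs
begin

text \<open>Let \<open>S(s)\<close> be the sum of \<open>a\<^sup>-\<^sup>s\<close> over \<open>a \<in> A\<close>. An integer that is a product of \<open>h\<close> distinct
  elements of \<open>A\<close> comes from at least \<open>h!\<close> ordered tuples, and the products with a repeated factor
  contribute only \<open>O(S(s)\<^bsup>h-2\<^esup>)\<close>, so \<open>\<zeta>(s) \<le> S(s)\<^sup>h / h! + O(S(s)\<^bsup>h-2\<^esup>)\<close>. If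
  \<open>A(x) < c x (log x)\<^bsup>1/h-1\<^esup>\<close> for large \<open>x\<close>, partial summation gives
  \<open>S(1+d) \<le> M + (1+d) c \<Gamma>(1/h) d\<^bsup>-1/h\<^esup>\<close>. Multiplying by \<open>d\<close> and letting \<open>d \<rightarrow> 0\<close> yields
  \<open>1 \<le> (c \<Gamma>(1/h))\<^sup>h / h!\<close>. All sums are truncated at \<open>N\<close>, with bounds uniform in \<open>N\<close>.\<close>

section \<open>Weighted counting of products of \<open>h\<close> factors\<close>

text \<open>Permuting the indices of an injective \<open>f\<close> leaves its product unchanged, and
  injectivity makes different permutations give different functions. The \<open>restrict\<close>
  keeps these functions inside the extensional function space.\<close>

lemma fact_le_card_inj_fibre:
  fixes B :: "nat set"
  assumes I: "finite I" and B: "finite B"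
    and f: "f \<in> I \<rightarrow>\<^sub>E B" "inj_on f I"
  shows "fact (card I) \<le> card {g \<in> I \<rightarrow>\<^sub>E B. inj_on g I \<and> prod g I = prod f I}"
proof -
  let ?r = "\<lambda>p. restrict (f \<circ> p) I"
  have inj: "inj_on ?r {p. p permutes I}"
  proof (rule inj_onI, safe)
    fix p q assume p: "p permutes I" and q: "q permutes I" and eq: "?r p = ?r q"
    show "p = q"
    proof
      fix i
      show "p i = q i"
      proof (cases "i \<in> I")
        case True
        then have "f (p i) = f (q i)" using fun_cong[OF eq, of i] by simp
        then show ?thesis
          using f(2) True permutes_in_image[OF p] permutes_in_image[OF q] by (auto dest: inj_onD)
      qed (use p q in \<open>auto simp: permutes_def\<close>)
    qed
  qed
  have sub: "?r ` {p. p permutes I} \<subseteq> {g \<in> I \<rightarrow>\<^sub>E B. inj_on g I \<and> prod g I = prod f I}"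
  proof (safe, goal_cases)
    case (1 _ p i)
    then show ?case using f(1) permutes_in_image[OF 1(1)] by auto
  next
    case (3 _ p)
    have "inj_on (f \<circ> p) I"
      using f(2) permutes_inj_on[OF 3] permutes_image[OF 3] by (intro comp_inj_on) auto
    then show ?case by (simp add: inj_on_restrict_eq)
  next
    case (4 _ p)
    have "prod (?r p) I = prod (f \<circ> p) I" by (intro prod.cong) auto
    also have "\<dots> = prod f I" using prod.permute[OF 4, of f] by simp
    finally show ?case .
  qed auto
  have "fact (card I) = card {p. p permutes I}"
    using card_permutations[OF refl I] by simp
  also have "\<dots> = card (?r ` {p. p permutes I})"
    using card_image[OF inj] by simp
  also have "\<dots> \<le> card {g \<in> I \<rightarrow>\<^sub>E B. inj_on g I \<and> prod g I = prod f I}"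
    by (intro card_mono sub finite_subset[OF _ finite_PiE[OF I, of "\<lambda>_. B"]]) (auto simp: B)
  finally show ?thesis .
qed

text \<open>Expanding the power of \<open>sum w B\<close> gives the sum of
  \<open>w (prod f I)\<close> over all \<open>f\<close> from \<open>I\<close> to \<open>B\<close>.
  Each \<open>n\<close> in \<open>X\<close> is hit by at least \<open>fact (card I)\<close>
  injective \<open>f\<close>, and the other terms are nonnegative.\<close>

lemma sum_products_of_distinct_le:
  fixes w :: "nat \<Rightarrow> real" and B X :: "nat set"
  assumes I: "finite I" and B: "finite B"
    and w0: "\<And>n. 0 \<le> w n" and wprod: "\<And>(f :: 'i \<Rightarrow> nat) J. finite J \<Longrightarrow> w (prod f J) = (\<Prod>j\<in>J. w (f j))"
    and X: "finite X" "\<And>n. n \<in> X \<Longrightarrow> \<exists>f \<in> (I :: 'i set) \<rightarrow>\<^sub>E B. inj_on f I \<and> prod f I = n"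
  shows "fact (card I) * sum w X \<le> (sum w B) ^ card I"
proof -
  let ?F = "I \<rightarrow>\<^sub>E B"
  let ?G = "{f \<in> ?F. inj_on f I}"
  let ?H = "{f \<in> ?G. prod f I \<in> X}"
  have fin: "finite ?F" using I B by (intro finite_PiE) auto
  have "fact (card I) * sum w X = (\<Sum>n\<in>X. fact (card I) * w n)"
    by (simp add: sum_distrib_left)
  also have "\<dots> \<le> (\<Sum>n\<in>X. real (card {f \<in> ?H. prod f I = n}) * w n)"
  proof (intro sum_mono mult_right_mono w0)
    fix n assume n: "n \<in> X"
    then obtain f where f: "f \<in> ?F" "inj_on f I" "prod f I = n" using X(2) by blast
    have "{f \<in> ?H. prod f I = n} = {g \<in> ?F. inj_on g I \<and> prod g I = prod f I}"
      using n f(3) by auto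
    then have "fact (card I) \<le> card {f \<in> ?H. prod f I = n}"
      using fact_le_card_inj_fibre[OF I B f(1,2)] by simp
    then have "real (fact (card I)) \<le> real (card {f \<in> ?H. prod f I = n})"
      by (rule of_nat_mono)
    then show "fact (card I) \<le> real (card {f \<in> ?H. prod f I = n})" by simp
  qed
  also have "\<dots> = (\<Sum>f\<in>?H. w (prod f I))"
    by (rule sum_fun_comp[symmetric]) (use fin X in auto)
  also have "\<dots> \<le> (\<Sum>f\<in>?F. w (prod f I))"
    by (rule sum_mono2) (use fin w0 in auto)
  also have "\<dots> = (\<Prod>i\<in>I. \<Sum>b\<in>B. w b)"
    using I B by (subst prod_sum_PiE) (auto simp: wprod)
  finally show ?thesis by simp
qed

text \<open>A product with a repeated factor, at positions \<open>i \<noteq> j\<close>, is determined by the factors at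
  the positions other than \<open>i\<close>; the one at \<open>j\<close> then counts with its square.\<close>
lemma sum_products_with_repetition_le:
  fixes w :: "nat \<Rightarrow> real" and B X :: "nat set"
  assumes I: "finite I" and B: "finite B"
    and w0: "\<And>n. 0 \<le> w n" and wprod: "\<And>(f :: 'i \<Rightarrow> nat) J. finite J \<Longrightarrow> w (prod f J) = (\<Prod>j\<in>J. w (f j))"
    and X: "\<And>n. n \<in> X \<Longrightarrow> \<exists>f \<in> (I :: 'i set) \<rightarrow>\<^sub>E B. \<not> inj_on f I \<and> prod f I = n"
  shows "sum w X \<le> (card I)\<^sup>2 * ((\<Sum>b\<in>B. (w b)\<^sup>2) * (sum w B) ^ (card I - 2))"
proof -
  define P where "P = {(i,j) \<in> I \<times> I. i \<noteq> j}"
  define T where "T = Sigma P (\<lambda>(i,j). (I - {i}) \<rightarrow>\<^sub>E B)"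
  define \<phi> :: "('i \<times> 'i) \<times> ('i \<Rightarrow> nat) \<Rightarrow> nat"
    where "\<phi> = (\<lambda>((i,j),g). \<Prod>k\<in>I - {i}. if k = j then g k ^ 2 else g k)"
  have finP: "finite P" unfolding P_def by (rule finite_subset[of _ "I \<times> I"]) (use I in auto)
  have finT: "finite T" unfolding T_def using I B finP by (auto intro!: finite_PiE)
  have nn: "0 \<le> (\<Sum>b\<in>B. (w b)\<^sup>2) * (sum w B) ^ (card I - 2)"
    by (intro mult_nonneg_nonneg sum_nonneg zero_le_power w0)
  have "X \<subseteq> \<phi> ` T"
  proof
    fix n assume "n \<in> X"
    then obtain f i j where f: "f \<in> I \<rightarrow>\<^sub>E B" "prod f I = n" and ij: "i \<in> I" "j \<in> I" "i \<noteq> j" "f i = f j"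
      using X unfolding inj_on_def by metis
    let ?g = "restrict f (I - {i})"
    have "\<phi> ((i,j), ?g) = (\<Prod>k\<in>I-{i}. if k = j then f k ^ 2 else f k)"
      unfolding \<phi>_def prod.case by (intro prod.cong) auto
    also have "\<dots> = f j ^ 2 * (\<Prod>k\<in>I-{i}-{j}. if k = j then f k ^ 2 else f k)"
      using I ij by (subst prod.remove[of _ j]) auto
    also have "(\<Prod>k\<in>I-{i}-{j}. if k = j then f k ^ 2 else f k) = prod f (I-{i}-{j})"
      by (intro prod.cong) auto
    also have "f j ^ 2 * \<dots> = f i * (f j * prod f (I-{i}-{j}))"
      using ij by (simp add: power2_eq_square)
    also have "f j * prod f (I-{i}-{j}) = prod f (I-{i})"
      using I ij by (intro prod.remove[symmetric]) auto
    also have "f i * \<dots> = n"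
      using I ij f(2) by (subst prod.remove[symmetric]) auto
    finally have "n = \<phi> ((i,j), ?g)" by (rule sym)
    moreover have "((i,j), ?g) \<in> T"
      using ij f(1) unfolding T_def P_def by auto
    ultimately show "n \<in> \<phi> ` T" by blast
  qed
  then have "sum w X \<le> sum w (\<phi> ` T)"
    using finT w0 by (intro sum_mono2) auto
  also have "\<dots> \<le> sum (w \<circ> \<phi>) T"
    using finT w0 by (intro sum_image_le) auto
  also have "\<dots> = (\<Sum>p\<in>P. \<Sum>g\<in>(case p of (i,j) \<Rightarrow> (I - {i}) \<rightarrow>\<^sub>E B). w (\<phi> (p, g)))"
    unfolding T_def using finP I B by (subst sum.Sigma) (auto intro!: finite_PiE simp: split_beta)
  also have "\<dots> = (\<Sum>p\<in>P. (\<Sum>b\<in>B. (w b)\<^sup>2) * (sum w B) ^ (card I - 2))"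
  proof (rule sum.cong[OF refl], safe)
    fix i j assume "(i,j) \<in> P"
    then have ij: "i \<in> I" "j \<in> I" "i \<noteq> j" by (auto simp: P_def)
    \<comment> \<open>Multiplicativity of \<open>w\<close> is available only for families indexed by
      \<open>'i\<close>, so the square is read as a constant family over the two distinct indices
      \<open>i\<close> and \<open>j\<close>.\<close>
    have sq: "w (n ^ 2) = (w n)\<^sup>2" for n :: nat
      using wprod[of "{i,j}" "\<lambda>_. n"] ij by (simp add: power2_eq_square)
    have "(\<Sum>g\<in>(I - {i}) \<rightarrow>\<^sub>E B. w (\<phi> ((i,j), g)))
        = (\<Sum>g\<in>(I - {i}) \<rightarrow>\<^sub>E B. \<Prod>k\<in>I - {i}. if k = j then (w (g k))\<^sup>2 else w (g k))"
      unfolding \<phi>_def prod.case wprod[OF finite_Diff[OF I]]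
      by (intro sum.cong prod.cong) (auto simp: sq)
    also have "\<dots> = (\<Prod>k\<in>I - {i}. \<Sum>b\<in>B. if k = j then (w b)\<^sup>2 else w b)"
      using I B by (subst prod_sum_PiE) auto
    also have "\<dots> = (\<Sum>b\<in>B. (w b)\<^sup>2) * (\<Prod>k\<in>I-{i}-{j}. \<Sum>b\<in>B. if k = j then (w b)\<^sup>2 else w b)"
      using I ij by (subst prod.remove[of _ j]) auto
    also have "(\<Prod>k\<in>I-{i}-{j}. \<Sum>b\<in>B. if k = j then (w b)\<^sup>2 else w b) = (\<Prod>k\<in>I-{i}-{j}. sum w B)"
      by (intro prod.cong sum.cong) auto
    also have "\<dots> = (sum w B) ^ (card I - 2)"
      using I ij by (simp add: card_Diff_singleton_if numeral_2_eq_2)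
    finally show "(\<Sum>g\<in>(I - {i}) \<rightarrow>\<^sub>E B. w (\<phi> ((i,j), g)))
        = (\<Sum>b\<in>B. (w b)\<^sup>2) * (sum w B) ^ (card I - 2)" .
  qed
  also have "\<dots> \<le> (card I)\<^sup>2 * ((\<Sum>b\<in>B. (w b)\<^sup>2) * (sum w B) ^ (card I - 2))"
  proof -
    have "card P \<le> card (I \<times> I)" using I by (intro card_mono) (auto simp: P_def)
    then have "real (card P) \<le> real ((card I)\<^sup>2)"
      unfolding card_cartesian_product power2_eq_square by (rule of_nat_mono)
    then show ?thesis using nn by (simp add: mult_right_mono)
  qed
  finally show ?thesis .
qed

text \<open>Elements of \<open>X\<close> with at least one injective representation go to the first
  estimate; every representation of a remaining element repeats a factor, so the second estimate
  applies.\<close>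

lemma sum_powr_products_le:
  fixes B X :: "nat set" and s :: real
  assumes I: "finite (I :: 'i set)" and B: "finite B" and X: "finite X"
    "\<And>n. n \<in> X \<Longrightarrow> \<exists>f \<in> I \<rightarrow>\<^sub>E B. prod f I = n"
  defines "S \<equiv> (\<Sum>b\<in>B. real b powr - s)"
  shows "(\<Sum>n\<in>X. real n powr - s)
    \<le> S ^ card I / fact (card I) + (card I)\<^sup>2 * ((\<Sum>b\<in>B. (real b powr - s)\<^sup>2) * S ^ (card I - 2))"
proof -
  let ?w = "\<lambda>n::nat. real n powr - s"
  let ?Y = "{n \<in> X. \<exists>f \<in> I \<rightarrow>\<^sub>E B. inj_on f I \<and> prod f I = n}"
  have wprod: "?w (prod f J) = (\<Prod>j\<in>J. ?w (f j))" if "finite J" for f :: "'i \<Rightarrow> nat" and J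
    using that by (induction rule: finite_induct) (auto simp: powr_mult)
  have "fact (card I) * sum ?w ?Y \<le> S ^ card I"
    unfolding S_def using X(1) by (intro sum_products_of_distinct_le I B wprod) auto
  then have "sum ?w ?Y \<le> S ^ card I / fact (card I)"
    by (simp add: field_simps)
  moreover have "sum ?w (X - ?Y) \<le> (card I)\<^sup>2 * ((\<Sum>b\<in>B. (?w b)\<^sup>2) * S ^ (card I - 2))"
    unfolding S_def using X(2) by (intro sum_products_with_repetition_le I B wprod) auto
  moreover have "sum ?w X = sum ?w (X - ?Y) + sum ?w ?Y"
    using X(1) by (intro sum.subset_diff) auto
  ultimately show ?thesis by linarith
qed

section \<open>From a counting bound to a bound for the Dirichlet sum\<close>

text \<open>This is Euler's integral for \<open>Gamma a\<close> after the substitution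
  \<open>u = d * t\<close>.\<close>

lemma has_integral_powr_mult_exp_minus:
  fixes d a :: real
  assumes "d > 0" "a > 0"
  shows "((\<lambda>t. t powr (a - 1) * exp (- d * t)) has_integral Gamma a / d powr a) {0..}"
proof -
  let ?f = "\<lambda>t::real. t powr (a - 1) / exp t"
  have im: "(\<lambda>t. d * t) ` {0..} = {0..}"
  proof safe
    fix x :: real assume "x \<ge> 0"
    then show "x \<in> (\<lambda>t. d * t) ` {0..}" using assms by (intro image_eqI[of _ _ "x / d"]) auto
  qed (use assms in auto)
  note G = Gamma_integral_real[OF assms(2)]
  \<comment> \<open>The change of variables concerns absolutely integrable functions; nonnegativity
    of \<open>?f\<close> supplies this for Euler's integral.\<close>
  have "(\<lambda>t. \<bar>d\<bar> * ?f (d * t)) absolutely_integrable_on {0..} \<and>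
        integral {0..} (\<lambda>t. \<bar>d\<bar> * ?f (d * t)) = Gamma a
     \<longleftrightarrow> ?f absolutely_integrable_on ((\<lambda>t. d * t) ` {0..}) \<and> integral ((\<lambda>t. d * t) ` {0..}) ?f = Gamma a"
    by (rule has_absolute_integral_change_of_variables_1')
       (use assms in \<open>auto intro!: derivative_eq_intros inj_onI\<close>)
  moreover have "?f absolutely_integrable_on {0..} \<and> integral {0..} ?f = Gamma a"
    using G by (auto intro!: nonnegative_absolutely_integrable_1 simp: integral_unique has_integral_integrable)
  ultimately have "(\<lambda>t. \<bar>d\<bar> * ?f (d * t)) absolutely_integrable_on {0..}"
      "integral {0..} (\<lambda>t. \<bar>d\<bar> * ?f (d * t)) = Gamma a"
    unfolding im by blast+
  then have "((\<lambda>t. \<bar>d\<bar> * ?f (d * t)) has_integral Gamma a) {0..}"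
    using set_lebesgue_integral_eq_integral(1) has_integral_integral by metis
  from has_integral_mult_right[OF this, of "1 / d powr a"]
  have "((\<lambda>t. 1 / d powr a * (\<bar>d\<bar> * ?f (d * t))) has_integral Gamma a / d powr a) {0..}" by simp
  moreover have "1 / d powr a * (\<bar>d\<bar> * ?f (d * t)) = t powr (a - 1) * exp (- d * t)"
    if "t \<in> {0..}" for t
    using assms that by (auto simp: powr_mult powr_diff exp_minus field_simps)
  ultimately show ?thesis by (subst has_integral_cong) auto
qed

text \<open>Write \<open>b\<^sup>-\<^sup>s\<close> as the integral of \<open>s e\<^sup>-\<^sup>s\<^sup>t\<close> over \<open>t \<ge> ln b\<close>, so that the sum becomes
  the integral of \<open>s e\<^sup>-\<^sup>s\<^sup>t A(e\<^sup>t)\<close>.\<close>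
lemma sum_powr_le_of_counting_bound:
  fixes d a c M :: real and B :: "nat set"
  assumes "d > 0" "a > 0" and B: "finite B" "B \<subseteq> {0<..}"
    and count: "\<And>t. t \<ge> 0 \<Longrightarrow> counting_function B (exp t) \<le> M + c * exp t * t powr (a - 1)"
  shows "(\<Sum>b\<in>B. real b powr - (1 + d)) \<le> M + (1 + d) * c * (Gamma a / d powr a)"
proof -
  define s where "s = 1 + d"
  have s: "s > 0" using assms by (simp add: s_def)
  let ?e = "\<lambda>t::real. s * exp (- s * t)"
  \<comment> \<open>Used twice: \<open>u = ln b\<close> yields the summand for \<open>b\<close>,
    while \<open>u = 0\<close> yields total mass 1, so that the constant \<open>M\<close>
    contributes exactly \<open>M\<close>.\<close>
  have e: "(?e has_integral exp (- s * u)) {u..}" for u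
    using has_integral_mult_right[OF has_integral_exp_minus_to_infinity[OF s, of u], of s] s by simp
  have "((\<lambda>t. if t \<in> {ln (real b)..} then ?e t else 0) has_integral real b powr - s) {0..}"
    if "b \<in> B" for b
  proof -
    have b: "b > 0" using that B by auto
    then have "((\<lambda>t. if t \<in> {ln (real b)..} then ?e t else 0) has_integral exp (- s * ln (real b))) {0..}"
      using e[of "ln (real b)"] by (subst has_integral_restrict) auto
    then show ?thesis using b by (simp add: powr_def)
  qed
  then have L: "((\<lambda>t. \<Sum>b\<in>B. if t \<in> {ln (real b)..} then ?e t else 0)
      has_integral (\<Sum>b\<in>B. real b powr - s)) {0..}"
    by (intro has_integral_sum B(1))
  have R: "((\<lambda>t. M * ?e t + s * c * (t powr (a - 1) * exp (- d * t)))
      has_integral M + s * c * (Gamma a / d powr a)) {0..}"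
    using has_integral_add[OF has_integral_mult_right[OF e[of 0], of M]
        has_integral_mult_right[OF has_integral_powr_mult_exp_minus[OF assms(1,2)], of "s * c"]]
    by simp
  show ?thesis
    unfolding s_def[symmetric]
  proof (rule has_integral_le[OF L R])
    fix t :: real assume "t \<in> {0..}"
    then have t: "t \<ge> 0" by simp
    have ln_le: "ln (real b) \<le> t \<longleftrightarrow> real b \<le> exp t" if "b \<in> B" for b
    proof -
      have "b > 0" using that B(2) by auto
      then show ?thesis using exp_le_cancel_iff[of "ln (real b)" t] by simp
    qed
    have "(\<Sum>b\<in>B. if t \<in> {ln (real b)..} then ?e t else 0) = (\<Sum>b\<in>{b\<in>B. real b \<le> exp t}. ?e t)"
      using B by (intro sum.mono_neutral_cong_right) (auto simp: ln_le)
    also have "\<dots> = counting_function B (exp t) * ?e t"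
      by (simp add: counting_function_def)
    also have "\<dots> \<le> (M + c * exp t * t powr (a - 1)) * ?e t"
      using count[OF t] s by (intro mult_right_mono) auto
    also have "\<dots> = M * ?e t + s * c * (t powr (a - 1) * (exp t * exp (- s * t)))"
      by (simp add: algebra_simps)
    also have "exp t * exp (- s * t) = exp (- d * t)"
      by (simp add: s_def exp_add[symmetric] algebra_simps)
    finally show "(\<Sum>b\<in>B. if t \<in> {ln (real b)..} then ?e t else 0)
        \<le> M * ?e t + s * c * (t powr (a - 1) * exp (- d * t))" .
  qed
qed

section \<open>Elementary bounds uniform in the truncation\<close>

text \<open>This stands in for the pole of the zeta function at 1. The bound telescopes:
  \<open>1 - d / x\<close> is at most \<open>(1 + 1 / x) powr - d\<close>, so the term at
  \<open>x\<close>, multiplied by \<open>d\<close>, is at least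
  \<open>x powr - d - (x + 1) powr - d\<close>.\<close>

lemma powr_sum_lower_bound:
  fixes d :: real
  assumes "d > 0"
  shows "1 - real (Suc N) powr - d \<le> d * (\<Sum>n\<in>{1..N}. real n powr - (1 + d))"
proof (induction N)
  case (Suc N)
  define x where "x = real (Suc N)"
  have x: "x > 0" by (simp add: x_def)
  have "1 - d * (1 / x) \<le> 1 - d * ln (1 + 1 / x)"
    using assms x ln_add_one_self_le_self[of "1 / x"] by (intro diff_left_mono mult_left_mono) auto
  also have "\<dots> \<le> exp (- d * ln (1 + 1 / x))"
    using exp_ge_add_one_self[of "- d * ln (1 + 1 / x)"] by simp
  also have "\<dots> = (1 + 1 / x) powr - d"
    using add_pos_pos[of 1 "1 / x"] x by (simp add: powr_def)
  finally have "x powr - d * (1 - d * (1 / x)) \<le> x powr - d * (1 + 1 / x) powr - d"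
    by (intro mult_left_mono) auto
  also have "\<dots> = (x + 1) powr - d"
    using x by (subst powr_mult[symmetric]) (auto simp: algebra_simps)
  finally have "x powr - d - (x + 1) powr - d \<le> d * (x powr - d * (1 / x))"
    by (simp add: algebra_simps)
  also have "x powr - d * (1 / x) = x powr - (1 + d)"
    using x powr_diff[of x "- d" 1] by (simp add: minus_diff_commute)
  finally show ?case using Suc by (simp add: x_def algebra_simps)
qed simp

lemma sum_inverse_squares_bound:
  assumes "finite B" "d \<ge> 0"
  shows "(\<Sum>b\<in>B. (real b powr - (1 + d))\<^sup>2) \<le> (\<Sum>n. inverse (real n ^ 2))"
proof -
  have "(\<Sum>b\<in>B. (real b powr - (1 + d))\<^sup>2) \<le> (\<Sum>b\<in>B. inverse (real b ^ 2))"
  proof (rule sum_mono)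
    fix b :: nat
    show "(real b powr - (1 + d))\<^sup>2 \<le> inverse (real b ^ 2)"
    \<comment> \<open>At \<open>b = 0\<close> both sides are 0, by the conventions for
      \<open>powr\<close> and \<open>inverse\<close>.\<close>
    proof (cases "b = 0")
      case False
      have "real b powr - (1 + d) \<le> real b powr - 1"
        using False assms by (intro powr_mono) auto
      then have "(real b powr - (1 + d))\<^sup>2 \<le> (real b powr - 1)\<^sup>2" by (intro power_mono) auto
      then show ?thesis using False by (simp add: powr_minus power_inverse)
    qed simp
  qed
  also have "\<dots> \<le> (\<Sum>n. inverse (real n ^ 2))"
    using assms by (intro sum_le_suminf inverse_power_summable) auto
  finally show ?thesis .
qed

text \<open>Each factor divides \<open>n\<close>, hence is at most \<open>N\<close>: truncating the
  basis at \<open>N\<close> loses no representation of the integers up to \<open>N\<close>.\<close>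

lemma basis_representation:
  assumes "multiplicative_basis h A" "n \<in> {1..N}"
  shows "\<exists>f \<in> {1..h} \<rightarrow>\<^sub>E (A \<inter> {1..N}). prod f {1..h} = n"
proof -
  obtain a where a: "\<And>i. i \<in> {1..h} \<Longrightarrow> a i \<in> A" "n = (\<Prod>i=1..h. a i)"
    using assms unfolding multiplicative_basis_def by (metis atLeastAtMost_iff less_le_trans zero_less_one)
  have "a i \<in> {1..N}" if "i \<in> {1..h}" for i
  proof -
    have "a i dvd n" using a(2) that by (auto intro: dvd_prodI)
    then show ?thesis using assms(2) by (auto dest: dvd_imp_le intro: Suc_leI dvd_pos_nat)
  qed
  then show ?thesis using a by (intro bexI[of _ "restrict a {1..h}"]) auto
qed

lemma counting_function_mono:
  "x \<le> y \<Longrightarrow> counting_function A x \<le> counting_function A y"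
  unfolding counting_function_def
  by (intro card_mono finite_subset[OF _ finite_atMost[of "nat \<lfloor>y\<rfloor>"]]) (auto simp: le_nat_floor)

lemma counting_function_subset_le:
  "B \<subseteq> A \<Longrightarrow> counting_function B x \<le> counting_function A x"
  unfolding counting_function_def
  by (intro card_mono finite_subset[OF _ finite_atMost[of "nat \<lfloor>x\<rfloor>"]]) (auto simp: le_nat_floor)

section \<open>The limit as \<open>d\<close> tends to 0\<close>

lemma fact_le_of_eventually_counting_less:
  fixes c :: real
  assumes h: "h > 0" and A: "multiplicative_basis h A"
    and ev: "eventually (\<lambda>x. real (counting_function A x) * (ln x powr (1 - 1 / real h) / x) < c) at_top"
  shows "fact h \<le> (c * Gamma (1 / real h)) ^ h"
proof -
  define a where "a = 1 / real h"
  have a: "a > 0" "real h * a = 1" using h by (auto simp: a_def)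
  obtain x1 where x1: "\<And>x. x \<ge> x1 \<Longrightarrow> real (counting_function A x) * (ln x powr (1 - a) / x) < c"
    using ev unfolding eventually_at_top_linorder a_def by blast
  \<comment> \<open>Up to \<open>x0\<close> the counting function is at most \<open>M\<close>.
    Beyond it \<open>exp t > 1\<close>, so \<open>t\<close> is positive and division by
    \<open>t powr (1 - a)\<close> is legitimate.\<close>
  define x0 where "x0 = max x1 1"
  define M where "M = real (counting_function A x0)"
  define K where "K = (\<Sum>n. inverse (real n ^ 2))"
  define U where "U d = M + (1 + d) * c * (Gamma a / d powr a)" for d
  have c: "c \<ge> 0"
  proof -
    have "0 \<le> real (counting_function A x0) * (ln x0 powr (1 - a) / x0)" by (simp add: x0_def)
    also have "\<dots> < c" by (rule x1) (simp add: x0_def)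
    finally show ?thesis by simp
  qed
  have count: "counting_function A (exp t) \<le> M + c * exp t * t powr (a - 1)" if "t \<ge> 0" for t
  proof (cases "exp t \<le> x0")
    case True
    then have "real (counting_function A (exp t)) \<le> M"
      using counting_function_mono[OF True, of A] by (simp add: M_def)
    moreover have "0 \<le> c * exp t * t powr (a - 1)" using c by simp
    ultimately show ?thesis by linarith
  next
    case False
    moreover have "x0 \<ge> 1" "x0 \<ge> x1" by (simp_all add: x0_def)
    ultimately have "exp t > 1" "exp t \<ge> x1" by linarith+
    then have t: "t > 0" by simp
    have "real (counting_function A (exp t)) * (t powr (1 - a) / exp t) < c"
      using x1[OF \<open>exp t \<ge> x1\<close>] by simp
    then have "real (counting_function A (exp t)) < c / (t powr (1 - a) / exp t)"
      using t by (subst pos_less_divide_eq) auto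
    also have "\<dots> = c * exp t * t powr (a - 1)"
      using t powr_minus[of t "1 - a"] by (simp add: field_simps)
    finally show ?thesis by (simp add: M_def)
  qed
  have bound: "1 \<le> d * (U d ^ h / fact h + (real h)\<^sup>2 * (K * U d ^ (h - 2)))" if d: "d > 0" for d
  proof -
    \<comment> \<open>The right-hand side does not depend on \<open>N\<close>, so for fixed
      \<open>d\<close> the limit in \<open>N\<close> turns the left-hand side into 1.\<close>
    have N: "1 - real (Suc N) powr - d \<le> d * (U d ^ h / fact h + (real h)\<^sup>2 * (K * U d ^ (h - 2)))" for N
    proof -
      define B where "B = A \<inter> {1..N}"
      define S where "S = (\<Sum>b\<in>B. real b powr - (1 + d))"
      define S2 where "S2 = (\<Sum>b\<in>B. (real b powr - (1 + d))\<^sup>2)"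
      have B: "finite B" "B \<subseteq> {0<..}" by (auto simp: B_def)
      have "counting_function B (exp t) \<le> M + c * exp t * t powr (a - 1)" if "t \<ge> 0" for t
        using count[OF that] counting_function_subset_le[of B A "exp t"] by (auto simp: B_def)
      then have SU: "S \<le> U d"
        unfolding S_def U_def by (intro sum_powr_le_of_counting_bound d a B)
      have S0: "S \<ge> 0" unfolding S_def by (intro sum_nonneg) auto
      have S2: "S2 \<le> K" "S2 \<ge> 0"
        unfolding S2_def K_def using sum_inverse_squares_bound[OF B(1), of d] d by (simp_all add: sum_nonneg)
      have "1 - real (Suc N) powr - d \<le> d * (\<Sum>n\<in>{1..N}. real n powr - (1 + d))"
        by (rule powr_sum_lower_bound[OF d])
      also have "\<dots> \<le> d * (S ^ h / fact h + (real h)\<^sup>2 * (S2 * S ^ (h - 2)))"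
        using sum_powr_products_le[of "{1..h}" B "{1..N}" "1 + d"] basis_representation[OF A] B d
        unfolding S_def S2_def B_def by (intro mult_left_mono) auto
      also have "\<dots> \<le> d * (U d ^ h / fact h + (real h)\<^sup>2 * (K * U d ^ (h - 2)))"
        using d SU S0 S2
        by (intro mult_left_mono add_mono divide_right_mono mult_mono power_mono) auto
      finally show ?thesis .
    qed
    have "((\<lambda>N. 1 - real (Suc N) powr - d) \<longlongrightarrow> 1 - 0) sequentially"
      using d by (intro tendsto_intros tendsto_neg_powr filterlim_compose[OF filterlim_real_sequentially filterlim_Suc]) auto
    then show ?thesis
      using N by (intro LIMSEQ_le_const2[of "\<lambda>N. 1 - real (Suc N) powr - d"]) auto
  qed
  \<comment> \<open>\<open>V d\<close> is \<open>d powr a * U d\<close>. Since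
    \<open>h * a = 1\<close>, the factor \<open>d\<close> is exactly absorbed by the
    \<open>h\<close>-th power, and \<open>V\<close> stays bounded near 0, with limit
    \<open>c * Gamma a\<close>.\<close>
  define V where "V d = M * d powr a + (1 + d) * c * Gamma a" for d
  \<comment> \<open>The power of \<open>d\<close> left over after \<open>U d ^ (h - 2)\<close> is
    rescaled: \<open>2 / h\<close> if \<open>h\<close> is at least 2, and 1 if \<open>h = 1\<close>,
    where \<open>h - 2\<close> is truncated to 0. As it is positive, the repeated-factor term
    vanishes in the limit.\<close>
  define r where "r = 1 - a * real (h - 2)"
  have r: "r > 0"
  proof -
    have "a * real (h - 2) < a * real h" using a h by (intro mult_strict_left_mono) auto
    then show ?thesis using a by (simp add: r_def mult.commute[of a])
  qed
  have VU: "d powr a * U d = V d" if "d > 0" for d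
    using that by (simp add: U_def V_def field_simps)
  have "1 \<le> V d ^ h / fact h + (real h)\<^sup>2 * (K * (d powr r * V d ^ (h - 2)))" if d: "d > 0" for d
  proof -
    have pw: "(d powr a) ^ k = d powr (a * real k)" for k
      using d by (simp add: powr_powr flip: powr_realpow)
    have "V d ^ h = d * U d ^ h"
      using d a by (simp add: VU[OF d, symmetric] power_mult_distrib pw mult.commute)
    moreover have "d powr r * V d ^ (h - 2) = d * U d ^ (h - 2)"
      using d by (simp add: VU[OF d, symmetric] power_mult_distrib pw r_def mult.assoc flip: powr_add)
    ultimately show ?thesis using bound[OF d] by (simp add: algebra_simps)
  qed
  then have ev1: "eventually (\<lambda>d. 1 \<le> V d ^ h / fact h + (real h)\<^sup>2 * (K * (d powr r * V d ^ (h - 2))))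
      (at_right 0)"
    by (auto simp: eventually_at_right_less eventually_at_filter)
  have p0: "((\<lambda>d. d powr q) \<longlongrightarrow> 0) (at_right 0)" if "q > 0" for q :: real
    using that by (intro tendsto_zero_powrI[OF tendsto_ident_at tendsto_const])
      (auto simp: eventually_at_filter)
  have V: "(V \<longlongrightarrow> M * 0 + (1 + 0) * c * Gamma a) (at_right 0)"
    unfolding V_def using a by (intro tendsto_intros p0) auto
  have "((\<lambda>d. V d ^ h / fact h + (real h)\<^sup>2 * (K * (d powr r * V d ^ (h - 2)))) \<longlongrightarrow>
      (M * 0 + (1 + 0) * c * Gamma a) ^ h / fact h
        + (real h)\<^sup>2 * (K * (0 * (M * 0 + (1 + 0) * c * Gamma a) ^ (h - 2)))) (at_right 0)"
    by (intro tendsto_intros V p0 r) auto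
  from tendsto_lowerbound[OF this ev1]
  have "1 \<le> (c * Gamma a) ^ h / fact h" by simp
  then show ?thesis by (simp add: a_def)
qed

theorem theorem3:
  fixes h :: nat and A :: "nat set"
  assumes "h > 0"
    and "multiplicative_basis h A"
  shows "Limsup at_top (\<lambda>x::real.
           ereal (real (counting_function A x) * (ln x powr (1 - 1 / real h) / x)))
         \<ge> ereal (root h (fact h) / Gamma (1 / real h))"
proof (rule ccontr)
  let ?f = "\<lambda>x. real (counting_function A x) * (ln x powr (1 - 1 / real h) / x)"
  let ?G = "Gamma (1 / real h)"
  have G: "?G > 0" using assms by (intro Gamma_real_pos) auto
  assume "\<not> ?thesis"
  then have "Limsup at_top (\<lambda>x. ereal (?f x)) < ereal (root h (fact h) / ?G)"
    by (rule not_le_imp_less)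
  \<comment> \<open>A real \<open>c\<close> strictly in between is needed: the preceding lemma,
    obtained by a limit, gives only a non-strict inequality.\<close>
  from ereal_dense2[OF this]
  obtain c where c: "Limsup at_top (\<lambda>x. ereal (?f x)) < ereal c" "c < root h (fact h) / ?G"
    by auto
  have ev: "eventually (\<lambda>x. ?f x < c) at_top"
    using Limsup_lessD[OF c(1)] by simp
  \<comment> \<open>A single point \<open>x\<close> with \<open>x \<ge> 1\<close> shows that
    \<open>c\<close> is nonnegative, which taking \<open>h\<close>-th powers of the strict
    inequality requires.\<close>
  then have "eventually (\<lambda>x. ?f x < c \<and> x \<ge> 1) at_top"
    by (intro eventually_conj eventually_ge_at_top)
  then obtain x where x: "?f x < c" "x \<ge> 1"
    unfolding eventually_at_top_linorder by blast
  have "0 \<le> ?f x" using x by simp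
  then have c0: "0 \<le> c" using x(1) by linarith
  have "c * ?G < root h (fact h)" using c(2) G by (simp add: field_simps)
  then have "(c * ?G) ^ h < root h (fact h) ^ h"
    using c0 G assms by (intro power_strict_mono) auto
  also have "\<dots> = fact h" using assms by (intro real_root_pow_pos2) auto
  finally show False
    using fact_le_of_eventually_counting_less[OF assms ev] by simp
qed

end
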